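(* Let $(X,d)$ be a metric space, $f:X\to\mathbb{R}\cup\{\pm\infty\}$ a function, $\bar x\in X$ with $|f(\bar x)|<\infty$, and let $\Phi\subseteq\mathrm{Lip}(X)/_\sim$. Suppose that $\Phi$ satisfies the local supporting distance property at $\bar x$ and (closed) balls in $\Phi$ are compact. Then $f^\downarrow(\bar x)>0$ if and only if $$\mathbf{0}\in\mathrm{int}\,\partial^{\rm loc}_\Phi f(\bar x).$$
   Context: $B(\cdot,r)$ denotes a closed ball. The steepest descent rate is $f^\downarrow(\bar x)=\liminf_{x\to\bar x}\frac{f(x)-f(\bar x)}{d(x,\bar x)}=\sup_{\delta>0}\inf_{x\in B(\bar x,\delta)\setminus\{\bar x\}}\frac{f(x)-f(\bar x)}{d(x,\bar x)}$ (with $\inf\varnothing=+\infty$). $\mathrm{Lip}(X)$ is the vector space of Lipschitz continuous functions $\phi:X\to\mathbb{R}$ with seminorm $\|\phi\|_{\rm Lip}=\sup_{x_1\ne x_2}\frac{|\phi(x_1)-\phi(x_2)|}{d(x_1,x_2)}$; $\phi_1\sim\phi_2$ iff $\phi_1-\phi_2$ is constant; $\mathrm{Lip}(X)/_\sim$ is the quotient, normed by $\|\cdot\|_{\rm Lip}$, with zero element $\mathbf{0}$. A class and its representatives are denoted by the same symbol; differences $\phi(x)-\phi(\bar x)$ do not depend on the representative. $\Phi$ is a metric space with the metric $d_{\rm Lip}(\phi_1,\phi_2)=\|\phi_1-\phi_2\|_{\rm Lip}$; balls centered at elements of $\Phi$ and the interior $\mathrm{int}$ are taken in $\Phi$. For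 $\epsilon\ge0$ define $\partial^{\rm loc}_{\Phi,\epsilon}f(\bar x)=\{\phi\in\Phi:\ \exists r>0:\ f(x)-f(\bar x)\ge\phi(x)-\phi(\bar x)-\epsilon d(x,\bar x)\ \forall x\in B(\bar x,r)\}$, and $\partial^{\rm loc}_\Phi f(\bar x)=\bigcap_{\epsilon>0}\partial^{\rm loc}_{\Phi,\epsilon}f(\bar x)$. A family $\Phi$ containing $\mathbf{0}$ satisfies the local supporting distance property at $\bar x$ if there exists $\kappa\in(0,+\infty)$ such that for every $\epsilon>0$ there is $r>0$ such that $\sup_{\phi\in B(\mathbf{0},\kappa\epsilon)}[\phi(x)-\phi(\bar x)]\ge\epsilon d(x,\bar x)$ for all $x\in B(\bar x,r)$. *)

theory Defs
  imports "HOL-Analysis.Analysis"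
begin

definition lip_fun :: "('a::metric_space \<Rightarrow> real) \<Rightarrow> bool" where
  "lip_fun \<phi> \<longleftrightarrow> (\<exists>C. C-lipschitz_on UNIV \<phi>)"

definition lip_rel :: "('a::metric_space \<Rightarrow> real) \<Rightarrow> ('a \<Rightarrow> real) \<Rightarrow> bool" where
  "lip_rel \<phi> \<psi> \<longleftrightarrow> lip_fun \<phi> \<and> lip_fun \<psi> \<and> (\<exists>c. \<forall>x. \<phi> x - \<psi> x = c)"

text \<open>The pairs with \<open>x = y\<close> contribute \<open>0 / 0 = 0\<close>: they leave the supremum over
  \<open>x \<noteq> y\<close> unchanged and make it \<open>0\<close> on a one-point space.\<close>

definition lip_seminorm :: "('a::metric_space \<Rightarrow> real) \<Rightarrow> real" where
  "lip_seminorm \<phi> = (SUP (x, y). \<bar>\<phi> x - \<phi> y\<bar> / dist x y)"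

lemma lip_funE:
  assumes "lip_fun \<phi>"
  obtains C where "C \<ge> 0" "\<And>x y. \<bar>\<phi> x - \<phi> y\<bar> \<le> C * dist x y"
  using assms unfolding lip_fun_def lipschitz_on_def dist_real_def by auto

lemma lip_funI:
  assumes "\<And>x y. \<bar>\<phi> x - \<phi> y\<bar> \<le> C * dist x y" "C \<ge> 0"
  shows "lip_fun \<phi>"
  using assms unfolding lip_fun_def lipschitz_on_def dist_real_def by auto

lemma lip_fun_zero: "lip_fun (\<lambda>_. 0)"
  by (rule lip_funI[where C = 0]) auto

lemma lip_fun_add:
  assumes "lip_fun \<phi>" "lip_fun \<psi>"
  shows "lip_fun (\<lambda>x. \<phi> x + \<psi> x)"
proof -
  from assms obtain C D where "C \<ge> 0" "\<And>x y. \<bar>\<phi> x - \<phi> y\<bar> \<le> C * dist x y"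
    "D \<ge> 0" "\<And>x y. \<bar>\<psi> x - \<psi> y\<bar> \<le> D * dist x y"
    by (metis lip_funE)
  then show ?thesis
    by (intro lip_funI[where C = "C + D"]) (smt (verit) distrib_right)+
qed

lemma lip_fun_scale:
  assumes "lip_fun \<phi>"
  shows "lip_fun (\<lambda>x. r * \<phi> x)"
proof -
  from assms obtain C where C: "C \<ge> 0" "\<And>x y. \<bar>\<phi> x - \<phi> y\<bar> \<le> C * dist x y"
    by (metis lip_funE)
  show ?thesis
  proof (rule lip_funI[where C = "\<bar>r\<bar> * C"])
    fix x y
    have "\<bar>r * \<phi> x - r * \<phi> y\<bar> = \<bar>r\<bar> * \<bar>\<phi> x - \<phi> y\<bar>"
      by (simp add: abs_mult flip: right_diff_distrib)
    also have "\<dots> \<le> \<bar>r\<bar> * (C * dist x y)"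
      by (intro mult_left_mono C) auto
    finally show "\<bar>r * \<phi> x - r * \<phi> y\<bar> \<le> \<bar>r\<bar> * C * dist x y"
      by (simp add: mult.assoc)
  qed (use C in auto)
qed

lemma lip_fun_uminus: "lip_fun \<phi> \<Longrightarrow> lip_fun (\<lambda>x. - \<phi> x)"
  using lip_fun_scale[of \<phi> "-1"] by simp

lemma lip_fun_diff: "lip_fun \<phi> \<Longrightarrow> lip_fun \<psi> \<Longrightarrow> lip_fun (\<lambda>x. \<phi> x - \<psi> x)"
  using lip_fun_add[OF _ lip_fun_uminus, of \<phi> \<psi>] by simp

lemma lip_seminorm_bdd:
  assumes "lip_fun \<phi>"
  shows "bdd_above (range (\<lambda>(x, y). \<bar>\<phi> x - \<phi> y\<bar> / dist x y))"
proof -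
  from assms obtain C where C: "C \<ge> 0" "\<And>x y. \<bar>\<phi> x - \<phi> y\<bar> \<le> C * dist x y"
    by (metis lip_funE)
  have "\<bar>\<phi> x - \<phi> y\<bar> / dist x y \<le> C" for x y
    using C by (cases "x = y") (auto simp: divide_le_eq)
  then show ?thesis
    by (intro bdd_aboveI[where M = C]) auto
qed

lemma lip_seminorm_upper:
  assumes "lip_fun \<phi>"
  shows "\<bar>\<phi> x - \<phi> y\<bar> \<le> lip_seminorm \<phi> * dist x y"
proof (cases "x = y")
  case False
  have "\<bar>\<phi> x - \<phi> y\<bar> / dist x y \<le> lip_seminorm \<phi>"
    unfolding lip_seminorm_def
    using cSUP_upper[OF UNIV_I lip_seminorm_bdd[OF assms], of "(x, y)"] by simp
  then show ?thesis
    using False by (simp add: divide_le_eq)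
qed simp

lemma lip_seminorm_least:
  assumes "\<And>x y. \<bar>\<phi> x - \<phi> y\<bar> \<le> C * dist x y" "C \<ge> 0"
  shows "lip_seminorm \<phi> \<le> C"
  unfolding lip_seminorm_def
proof (rule cSUP_least)
  fix p :: "'a \<times> 'a"
  obtain x y where p: "p = (x, y)" by (cases p)
  show "(case p of (x, y) \<Rightarrow> \<bar>\<phi> x - \<phi> y\<bar> / dist x y) \<le> C"
    unfolding p using assms by (cases "x = y") (auto simp: divide_le_eq)
qed simp

lemma lip_seminorm_nonneg:
  assumes "lip_fun \<phi>"
  shows "0 \<le> lip_seminorm \<phi>"
  unfolding lip_seminorm_def
  using cSUP_upper[OF UNIV_I lip_seminorm_bdd[OF assms], of "(undefined, undefined)"] by simp

lemma lip_rel_iff: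
  "lip_rel \<phi> \<psi> \<longleftrightarrow> lip_fun \<phi> \<and> lip_fun \<psi> \<and> (\<forall>x y. \<phi> x - \<phi> y = \<psi> x - \<psi> y)"
  unfolding lip_rel_def by (smt (verit))

quotient_type (overloaded) 'a lip_quot = "'a::metric_space \<Rightarrow> real" / partial: lip_rel
proof (rule part_equivpI)
  show "\<exists>\<phi>. lip_rel \<phi> (\<phi> :: 'a \<Rightarrow> real)"
    using lip_fun_zero unfolding lip_rel_iff by auto
  show "symp (lip_rel :: ('a \<Rightarrow> real) \<Rightarrow> _)"
    by (rule sympI) (simp add: lip_rel_iff)
  show "transp (lip_rel :: ('a \<Rightarrow> real) \<Rightarrow> _)"
    by (rule transpI) (simp add: lip_rel_iff)
qed

lift_definition lip_incr :: "'a::metric_space lip_quot \<Rightarrow> 'a \<Rightarrow> 'a \<Rightarrow> real"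
  is "\<lambda>\<phi> x y. \<phi> x - \<phi> y"
  by (auto simp: lip_rel_iff)

instantiation lip_quot :: (metric_space) real_normed_vector
begin

lift_definition zero_lip_quot :: "'a lip_quot" is "\<lambda>_. 0"
  by (auto simp: lip_rel_iff lip_fun_zero)

lift_definition plus_lip_quot :: "'a lip_quot \<Rightarrow> 'a lip_quot \<Rightarrow> 'a lip_quot"
  is "\<lambda>\<phi> \<psi> x. \<phi> x + \<psi> x"
  by (auto simp: lip_rel_iff lip_fun_add) (smt (verit))

lift_definition minus_lip_quot :: "'a lip_quot \<Rightarrow> 'a lip_quot \<Rightarrow> 'a lip_quot"
  is "\<lambda>\<phi> \<psi> x. \<phi> x - \<psi> x"
  by (auto simp: lip_rel_iff lip_fun_diff) (smt (verit))

lift_definition uminus_lip_quot :: "'a lip_quot \<Rightarrow> 'a lip_quot" is "\<lambda>\<phi> x. - \<phi> x"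
  by (auto simp: lip_rel_iff lip_fun_uminus)

lift_definition scaleR_lip_quot :: "real \<Rightarrow> 'a lip_quot \<Rightarrow> 'a lip_quot"
  is "\<lambda>r \<phi> x. r * \<phi> x"
  by (auto simp: lip_rel_iff lip_fun_scale simp flip: right_diff_distrib)

lift_definition norm_lip_quot :: "'a lip_quot \<Rightarrow> real" is lip_seminorm
  by (auto simp: lip_rel_iff lip_seminorm_def)

definition dist_lip_quot :: "'a lip_quot \<Rightarrow> 'a lip_quot \<Rightarrow> real" where
  "dist_lip_quot \<phi> \<psi> = norm (\<phi> - \<psi>)"

definition sgn_lip_quot :: "'a lip_quot \<Rightarrow> 'a lip_quot" where
  "sgn_lip_quot \<phi> = inverse (norm \<phi>) *\<^sub>R \<phi>"

definition uniformity_lip_quot :: "('a lip_quot \<times> 'a lip_quot) filter" where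
  "uniformity_lip_quot = (INF e\<in>{0<..}. principal {(x, y). dist x y < e})"

definition open_lip_quot :: "'a lip_quot set \<Rightarrow> bool" where
  "open_lip_quot U \<longleftrightarrow>
    (\<forall>x\<in>U. eventually (\<lambda>(x', y). x' = x \<longrightarrow> y \<in> U) uniformity)"

instance
proof
  fix \<phi> \<psi> \<theta> :: "'a lip_quot" and a b :: real
  show "\<phi> + \<psi> + \<theta> = \<phi> + (\<psi> + \<theta>)"
    by transfer (auto simp: lip_rel_iff lip_fun_add)
  show "\<phi> + \<psi> = \<psi> + \<phi>"
    by transfer (auto simp: lip_rel_iff lip_fun_add)
  show "0 + \<phi> = \<phi>"
    by transfer (auto simp: lip_rel_iff)
  show "- \<phi> + \<phi> = 0"
    by transfer (auto simp: lip_rel_iff lip_fun_zero)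
  show "\<phi> - \<psi> = \<phi> + - \<psi>"
    by transfer (auto simp: lip_rel_iff lip_fun_diff)
  show "a *\<^sub>R (\<phi> + \<psi>) = a *\<^sub>R \<phi> + a *\<^sub>R \<psi>"
    by transfer (auto simp: lip_rel_iff lip_fun_add lip_fun_scale algebra_simps)
  show "(a + b) *\<^sub>R \<phi> = a *\<^sub>R \<phi> + b *\<^sub>R \<phi>"
    by transfer (auto simp: lip_rel_iff lip_fun_add lip_fun_scale algebra_simps)
  show "a *\<^sub>R b *\<^sub>R \<phi> = (a * b) *\<^sub>R \<phi>"
    by transfer (auto simp: lip_rel_iff lip_fun_scale mult.assoc[symmetric])
  show "1 *\<^sub>R \<phi> = \<phi>"
    by transfer (auto simp: lip_rel_iff)
  show "(norm \<phi> = 0) = (\<phi> = 0)"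
  proof transfer
    fix \<phi> :: "'a \<Rightarrow> real"
    assume "lip_rel \<phi> \<phi>"
    then have \<phi>: "lip_fun \<phi>" by (simp add: lip_rel_iff)
    show "(lip_seminorm \<phi> = 0) = lip_rel \<phi> (\<lambda>_. 0)"
    proof
      assume "lip_seminorm \<phi> = 0"
      then show "lip_rel \<phi> (\<lambda>_. 0)"
        using lip_seminorm_upper[OF \<phi>] \<phi> by (simp add: lip_rel_iff lip_fun_zero)
    next
      assume "lip_rel \<phi> (\<lambda>_. 0)"
      then show "lip_seminorm \<phi> = 0"
        using lip_seminorm_least[of \<phi> 0] lip_seminorm_nonneg[OF \<phi>]
        by (simp add: lip_rel_iff)
    qed
  qed
  show "norm (\<phi> + \<psi>) \<le> norm \<phi> + norm \<psi>"
  proof transfer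
    fix \<phi> \<psi> :: "'a \<Rightarrow> real"
    assume "lip_rel \<phi> \<phi>" "lip_rel \<psi> \<psi>"
    then have *: "lip_fun \<phi>" "lip_fun \<psi>" by (simp_all add: lip_rel_iff)
    show "lip_seminorm (\<lambda>x. \<phi> x + \<psi> x) \<le> lip_seminorm \<phi> + lip_seminorm \<psi>"
    proof (rule lip_seminorm_least)
      fix x y
      show "\<bar>\<phi> x + \<psi> x - (\<phi> y + \<psi> y)\<bar> \<le> (lip_seminorm \<phi> + lip_seminorm \<psi>) * dist x y"
        using lip_seminorm_upper[OF *(1), of x y] lip_seminorm_upper[OF *(2), of x y]
        by (simp add: distrib_right)
    qed (intro add_nonneg_nonneg lip_seminorm_nonneg *)
  qed
  show "norm (a *\<^sub>R \<phi>) = \<bar>a\<bar> * norm \<phi>"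
  proof transfer
    fix a and \<phi> :: "'a \<Rightarrow> real"
    assume "lip_rel \<phi> \<phi>"
    then have \<phi>: "lip_fun \<phi>" by (simp add: lip_rel_iff)
    have le: "lip_seminorm (\<lambda>x. b * \<psi> x) \<le> \<bar>b\<bar> * lip_seminorm \<psi>"
      if \<psi>: "lip_fun \<psi>" for b and \<psi> :: "'a \<Rightarrow> real"
    proof (rule lip_seminorm_least)
      fix x y
      have "\<bar>b * \<psi> x - b * \<psi> y\<bar> = \<bar>b\<bar> * \<bar>\<psi> x - \<psi> y\<bar>"
        by (simp add: abs_mult flip: right_diff_distrib)
      also have "\<dots> \<le> \<bar>b\<bar> * (lip_seminorm \<psi> * dist x y)"
        by (intro mult_left_mono lip_seminorm_upper \<psi>) auto
      finally show "\<bar>b * \<psi> x - b * \<psi> y\<bar> \<le> \<bar>b\<bar> * lip_seminorm \<psi> * dist x y"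
        by (simp add: mult.assoc)
    qed (use lip_seminorm_nonneg[OF \<psi>] in auto)
    show "lip_seminorm (\<lambda>x. a * \<phi> x) = \<bar>a\<bar> * lip_seminorm \<phi>"
    proof (cases "a = 0")
      case True
      then show ?thesis
        using le[OF \<phi>, of a] lip_seminorm_nonneg[OF lip_fun_scale[OF \<phi>, of a]] by simp
    next
      case False
      have "lip_seminorm \<phi> \<le> \<bar>inverse a\<bar> * lip_seminorm (\<lambda>x. a * \<phi> x)"
        using le[OF lip_fun_scale[OF \<phi>, of a], of "inverse a"] False
        by (simp add: mult.assoc[symmetric])
      then have "\<bar>a\<bar> * lip_seminorm \<phi> \<le> lip_seminorm (\<lambda>x. a * \<phi> x)"
        using False by (simp add: field_simps abs_inverse)
      with le[OF \<phi>, of a] show ?thesis by simp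
    qed
  qed
qed (simp_all add: dist_lip_quot_def sgn_lip_quot_def uniformity_lip_quot_def open_lip_quot_def)

end

definition descent_rate :: "('a::metric_space \<Rightarrow> ereal) \<Rightarrow> 'a \<Rightarrow> ereal" where
  "descent_rate f xb = Liminf (at xb) (\<lambda>x. (f x - f xb) / ereal (dist x xb))"

lemma descent_rate_eq_SUP_INF:
  "descent_rate f xb =
    (SUP \<delta>\<in>{0<..}. INF x\<in>cball xb \<delta> - {xb}. (f x - f xb) / ereal (dist x xb))"
  (is "_ = (SUP \<delta>\<in>_. ?I (cball xb \<delta>))")
proof -
  have "descent_rate f xb = (SUP \<delta>\<in>{0<..}. ?I (ball xb \<delta>))"
    unfolding descent_rate_def Liminf_within by simp
  also have "\<dots> = (SUP \<delta>\<in>{0<..}. ?I (cball xb \<delta>))"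
  proof (intro antisym SUP_mono)
    fix \<delta> :: real assume "\<delta> \<in> {0<..}"
    then have "?I (ball xb \<delta>) \<le> ?I (cball xb (\<delta> / 2))" "\<delta> / 2 \<in> {0<..}"
      by (auto intro!: INF_superset_mono)
    then show "\<exists>\<eta>\<in>{0<..}. ?I (ball xb \<delta>) \<le> ?I (cball xb \<eta>)" by blast
  next
    fix \<delta> :: real assume "\<delta> \<in> {0<..}"
    moreover have "?I (cball xb \<delta>) \<le> ?I (ball xb \<delta>)"
      by (rule INF_superset_mono) auto
    ultimately show "\<exists>\<eta>\<in>{0<..}. ?I (cball xb \<delta>) \<le> ?I (ball xb \<eta>)" by blast
  qed
  finally show ?thesis .
qed

definition loc_subdiff_eps ::
  "'a::metric_space lip_quot set \<Rightarrow> real \<Rightarrow> ('a \<Rightarrow> ereal) \<Rightarrow> 'a \<Rightarrow> 'a lip_quot set" where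
  "loc_subdiff_eps \<Phi> \<epsilon> f xb =
    {\<phi>\<in>\<Phi>. \<exists>r>0. \<forall>x\<in>cball xb r. f x - f xb \<ge> ereal (lip_incr \<phi> x xb - \<epsilon> * dist x xb)}"

definition loc_subdiff ::
  "'a::metric_space lip_quot set \<Rightarrow> ('a \<Rightarrow> ereal) \<Rightarrow> 'a \<Rightarrow> 'a lip_quot set" where
  "loc_subdiff \<Phi> f xb = (\<Inter>\<epsilon>\<in>{0<..}. loc_subdiff_eps \<Phi> \<epsilon> f xb)"

definition local_supporting_distance :: "'a::metric_space lip_quot set \<Rightarrow> 'a \<Rightarrow> bool" where
  "local_supporting_distance \<Phi> xb \<longleftrightarrow> 0 \<in> \<Phi> \<and>
    (\<exists>\<kappa>>0. \<forall>\<epsilon>>0. \<exists>r>0. \<forall>x\<in>cball xb r.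
      (SUP \<phi>\<in>cball 0 (\<kappa> * \<epsilon>) \<inter> \<Phi>. ereal (lip_incr \<phi> x xb)) \<ge> ereal (\<epsilon> * dist x xb))"

end

theory Submission
  imports Defs
begin

text \<open>
  A descent rate above \<open>c > 0\<close> makes every \<open>\<phi>\<close> of norm at most \<open>c\<close> a local support of \<open>f\<close>.
  Conversely, if a ball \<open>K\<close> of \<open>\<Phi>\<close> around \<open>0\<close> consists of local subgradients, each of them supports
  \<open>f\<close> up to an error \<open>\<epsilon> d(x, xb)\<close> on a neighbourhood depending on it; a finite net of the compact
  set \<open>K\<close> makes the neighbourhood uniform, and the supporting distance property then bounds
  \<open>f x - f xb\<close> below by a multiple of the distance.
\<close>

lemma lip_incr_le: "lip_incr \<phi> x y \<le> norm \<phi> * dist x y"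
proof (transfer fixing: x y)
  fix \<phi> :: "'a \<Rightarrow> real"
  assume "lip_rel \<phi> \<phi>"
  then have "lip_fun \<phi>" by (simp add: lip_rel_iff)
  from lip_seminorm_upper[OF this, of x y]
  show "\<phi> x - \<phi> y \<le> lip_seminorm \<phi> * dist x y" by linarith
qed

lemma lip_incr_self [simp]: "lip_incr \<phi> x x = 0"
  by (transfer fixing: x) simp

lemma lip_incr_diff: "lip_incr (\<phi> - \<psi>) x y = lip_incr \<phi> x y - lip_incr \<psi> x y"
  by (transfer fixing: x y) simp

text \<open>The increment of \<open>\<phi> - \<psi>\<close> is at most its norm times the distance.
  This carries a support inequality from a net point \<open>\<psi>\<close> over to a nearby
  \<open>\<phi>\<close>.\<close>

lemma lip_incr_le_add: "lip_incr \<phi> x y \<le> lip_incr \<psi> x y + dist \<phi> \<psi> * dist x y"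
  using lip_incr_le[of "\<phi> - \<psi>" x y] by (simp add: lip_incr_diff dist_norm)

text \<open>A supremum over radii is positive exactly when the infimum for some radius is.
  Multiplying out the quotient gives linear growth of \<open>f\<close> at \<open>xb\<close>, a form
  that both directions of the theorem can use directly.\<close>

lemma descent_rate_pos_iff:
  assumes "\<bar>f xb\<bar> < \<infinity>"
  shows "descent_rate f xb > 0 \<longleftrightarrow>
    (\<exists>c>0. \<exists>r>0. \<forall>x\<in>cball xb r. ereal (c * dist x xb) \<le> f x - f xb)"
proof
  assume "descent_rate f xb > 0"
  then obtain \<delta> where \<delta>: "\<delta> > 0"
    and pos: "0 < (INF x\<in>cball xb \<delta> - {xb}. (f x - f xb) / ereal (dist x xb))"
    unfolding descent_rate_eq_SUP_INF by (auto simp: less_SUP_iff)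
  \<comment> \<open>The infimum may be infinite, for instance over an empty punctured ball, so a
    real slope strictly below it is chosen.\<close>
  from ereal_dense2[OF pos] obtain c where c: "c > 0"
    and le: "ereal c < (INF x\<in>cball xb \<delta> - {xb}. (f x - f xb) / ereal (dist x xb))"
    by auto
  have "ereal (c * dist x xb) \<le> f x - f xb" if "x \<in> cball xb \<delta>" for x
  proof (cases "x = xb")
    case True
    then show ?thesis using assms by (cases "f xb") auto
  next
    case False
    with that le have "ereal c < (f x - f xb) / ereal (dist x xb)"
      by (auto dest: less_INF_D)
    with False show ?thesis
      by (simp add: ereal_less_divide_pos less_imp_le mult.commute)
  qed
  with c \<delta> show "\<exists>c>0. \<exists>r>0. \<forall>x\<in>cball xb r. ereal (c * dist x xb) \<le> f x - f xb"
    by blast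
next
  assume "\<exists>c>0. \<exists>r>0. \<forall>x\<in>cball xb r. ereal (c * dist x xb) \<le> f x - f xb"
  then obtain c r where c: "c > 0" and r: "r > 0"
    and le: "\<And>x. x \<in> cball xb r \<Longrightarrow> ereal (c * dist x xb) \<le> f x - f xb" by blast
  have "ereal c \<le> (INF x\<in>cball xb r - {xb}. (f x - f xb) / ereal (dist x xb))"
  proof (rule INF_greatest)
    fix x assume "x \<in> cball xb r - {xb}"
    with le[of x] show "ereal c \<le> (f x - f xb) / ereal (dist x xb)"
      by (simp add: ereal_le_divide_pos mult.commute)
  qed
  also have "\<dots> \<le> descent_rate f xb"
    unfolding descent_rate_eq_SUP_INF using r by (intro SUP_upper) auto
  finally show "descent_rate f xb > 0"
    using c by (metis ereal_less(2) less_le_trans)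
qed

text \<open>Relatively open sets are traces of open sets, and each of these contains a closed ball
  around \<open>0\<close>. Closed balls are used because compactness is assumed for them.\<close>

lemma zero_in_interior_of_iff:
  fixes S T :: "'b::real_normed_vector set"
  assumes "T \<subseteq> S"
  shows "0 \<in> top_of_set S interior_of T \<longleftrightarrow> 0 \<in> S \<and> (\<exists>e>0. cball 0 e \<inter> S \<subseteq> T)"
proof
  assume "0 \<in> top_of_set S interior_of T"
  then obtain U where U: "open U" "0 \<in> U" "0 \<in> S" "S \<inter> U \<subseteq> T"
    by (auto simp: interior_of_def openin_open)
  then obtain e where "e > 0" "cball 0 e \<subseteq> U"
    by (auto simp: open_contains_cball)
  with U show "0 \<in> S \<and> (\<exists>e>0. cball 0 e \<inter> S \<subseteq> T)" by blast
next
  assume "0 \<in> S \<and> (\<exists>e>0. cball 0 e \<inter> S \<subseteq> T)"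
  then obtain e where "0 \<in> S" "e > 0" "cball 0 e \<inter> S \<subseteq> T" by blast
  then show "0 \<in> top_of_set S interior_of T"
    unfolding interior_of_def
    by (intro CollectI exI[of _ "S \<inter> ball 0 e"]) (auto intro: openin_open_Int)
qed

text \<open>The error \<open>\<epsilon>\<close> is split: one half is the support error at a net
  point, the other pays for passing from \<open>\<phi>\<close> to that point. Only the finitely many
  radii of the net points then matter.\<close>

lemma loc_subdiff_uniform_radius:
  assumes fin: "\<bar>f xb\<bar> < \<infinity>"
    and K: "compact K" "K \<subseteq> loc_subdiff \<Phi> f xb"
    and \<epsilon>: "\<epsilon> > 0"
  obtains r where "r > 0"
    and "\<And>\<phi> x. \<phi> \<in> K \<Longrightarrow> x \<in> cball xb r \<Longrightarrow>
      ereal (lip_incr \<phi> x xb - \<epsilon> * dist x xb) \<le> f x - f xb"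
proof -
  have "\<forall>\<phi>\<in>K. \<exists>r>0. \<forall>x\<in>cball xb r. ereal (lip_incr \<phi> x xb - \<epsilon> / 2 * dist x xb) \<le> f x - f xb"
  proof
    fix \<phi> assume "\<phi> \<in> K"
    with K \<epsilon> have "\<phi> \<in> loc_subdiff_eps \<Phi> (\<epsilon> / 2) f xb"
      unfolding loc_subdiff_def by (auto dest: subsetD)
    then show "\<exists>r>0. \<forall>x\<in>cball xb r. ereal (lip_incr \<phi> x xb - \<epsilon> / 2 * dist x xb) \<le> f x - f xb"
      by (simp add: loc_subdiff_eps_def)
  qed
  then obtain \<rho> where \<rho>: "\<And>\<phi>. \<phi> \<in> K \<Longrightarrow> \<rho> \<phi> > 0"
    and supp: "\<And>\<phi> x. \<phi> \<in> K \<Longrightarrow> x \<in> cball xb (\<rho> \<phi>) \<Longrightarrow>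
      ereal (lip_incr \<phi> x xb - \<epsilon> / 2 * dist x xb) \<le> f x - f xb"
    by metis
  obtain N where N: "finite N" "N \<subseteq> K" "K \<subseteq> (\<Union>\<psi>\<in>N. ball \<psi> (\<epsilon> / 2))"
    using seq_compact_imp_totally_bounded[OF compact_imp_seq_compact[OF K(1)],
        rule_format, of "\<epsilon> / 2"] \<epsilon> by auto
  \<comment> \<open>The extra \<open>1\<close> keeps the minimum meaningful when the net is
    empty.\<close>
  define r where "r = Min (insert 1 (\<rho> ` N))"
  have "r > 0" using N \<rho> unfolding r_def by auto
  moreover have "ereal (lip_incr \<phi> x xb - \<epsilon> * dist x xb) \<le> f x - f xb"
    if "\<phi> \<in> K" "x \<in> cball xb r" for \<phi> x
  proof -
    from that(1) N(3) have "\<phi> \<in> (\<Union>\<psi>\<in>N. ball \<psi> (\<epsilon> / 2))" by (rule rev_subsetD)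
    then obtain \<psi> where \<psi>: "\<psi> \<in> N" "dist \<phi> \<psi> < \<epsilon> / 2"
      by (auto simp: dist_commute)
    have "dist \<phi> \<psi> * dist x xb \<le> \<epsilon> / 2 * dist x xb"
      using \<psi> by (intro mult_right_mono) auto
    then have "lip_incr \<phi> x xb - \<epsilon> * dist x xb \<le> lip_incr \<psi> x xb - \<epsilon> / 2 * dist x xb"
      using lip_incr_le_add[of \<phi> x xb \<psi>] by simp
    then have "ereal (lip_incr \<phi> x xb - \<epsilon> * dist x xb)
        \<le> ereal (lip_incr \<psi> x xb - \<epsilon> / 2 * dist x xb)" by simp
    also have "\<dots> \<le> f x - f xb"
    proof (rule supp)
      show "\<psi> \<in> K" using N(2) \<psi>(1) by blast
      have "r \<le> \<rho> \<psi>"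
        using N(1) \<psi>(1) unfolding r_def by (intro Min_le) auto
      with that(2) show "x \<in> cball xb (\<rho> \<psi>)" by simp
    qed
    finally show ?thesis .
  qed
  ultimately show thesis by (rule that)
qed

theorem corollary2:
  fixes f :: "'a::metric_space \<Rightarrow> ereal" and xb :: 'a and \<Phi> :: "'a lip_quot set"
  assumes "\<bar>f xb\<bar> < \<infinity>"
    and "local_supporting_distance \<Phi> xb"
    and "\<And>\<phi> r. \<phi> \<in> \<Phi> \<Longrightarrow> compact (cball \<phi> r \<inter> \<Phi>)"
  shows "descent_rate f xb > 0 \<longleftrightarrow> 0 \<in> top_of_set \<Phi> interior_of loc_subdiff \<Phi> f xb"
proof -
  from assms(2) obtain \<kappa> where zero: "0 \<in> \<Phi>" and \<kappa>: "\<kappa> > 0"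
    and lsd: "\<And>\<epsilon>. \<epsilon> > 0 \<Longrightarrow> \<exists>r>0. \<forall>x\<in>cball xb r.
      ereal (\<epsilon> * dist x xb) \<le> (SUP \<phi>\<in>cball 0 (\<kappa> * \<epsilon>) \<inter> \<Phi>. ereal (lip_incr \<phi> x xb))"
    unfolding local_supporting_distance_def by blast
  \<comment> \<open>Any single positive error, here \<open>1\<close>, already places the
    intersection inside \<open>\<Phi>\<close>.\<close>
  have "loc_subdiff \<Phi> f xb \<subseteq> loc_subdiff_eps \<Phi> 1 f xb"
    unfolding loc_subdiff_def by (rule INT_lower) simp
  also have "\<dots> \<subseteq> \<Phi>"
    by (auto simp: loc_subdiff_eps_def)
  finally have interior: "0 \<in> top_of_set \<Phi> interior_of loc_subdiff \<Phi> f xb \<longleftrightarrow>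
      (\<exists>e>0. cball 0 e \<inter> \<Phi> \<subseteq> loc_subdiff \<Phi> f xb)"
    using zero by (simp add: zero_in_interior_of_iff)
  show ?thesis
    unfolding interior descent_rate_pos_iff[where f = f, OF assms(1)]
  proof
    assume "\<exists>c>0. \<exists>r>0. \<forall>x\<in>cball xb r. ereal (c * dist x xb) \<le> f x - f xb"
    then obtain c r where c: "c > 0" and r: "r > 0"
      and le: "\<And>x. x \<in> cball xb r \<Longrightarrow> ereal (c * dist x xb) \<le> f x - f xb" by blast
    \<comment> \<open>The growth slope \<open>c\<close> itself serves as the radius of the ball in
      \<open>\<Phi>\<close>, and the same \<open>r\<close> works for all \<open>\<phi>\<close> and
      \<open>\<epsilon>\<close>.\<close>
    have "\<phi> \<in> loc_subdiff_eps \<Phi> \<epsilon> f xb" if "\<phi> \<in> cball 0 c \<inter> \<Phi>" "\<epsilon> > 0" for \<phi> \<epsilon>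
    proof -
      have "ereal (lip_incr \<phi> x xb - \<epsilon> * dist x xb) \<le> f x - f xb" if x: "x \<in> cball xb r" for x
      proof -
        have "norm \<phi> * dist x xb \<le> c * dist x xb" "0 \<le> \<epsilon> * dist x xb"
          using \<open>\<phi> \<in> cball 0 c \<inter> \<Phi>\<close> \<open>\<epsilon> > 0\<close> by (auto intro: mult_right_mono)
        with lip_incr_le[of \<phi> x xb]
        have "lip_incr \<phi> x xb - \<epsilon> * dist x xb \<le> c * dist x xb" by linarith
        with le[OF x] show ?thesis by (meson ereal_less_eq(3) order_trans)
      qed
      with that r show ?thesis by (auto simp: loc_subdiff_eps_def)
    qed
    with c show "\<exists>e>0. cball 0 e \<inter> \<Phi> \<subseteq> loc_subdiff \<Phi> f xb"
      unfolding loc_subdiff_def by blast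
  next
    assume "\<exists>e>0. cball 0 e \<inter> \<Phi> \<subseteq> loc_subdiff \<Phi> f xb"
    then obtain e where e: "e > 0" and sub: "cball 0 e \<inter> \<Phi> \<subseteq> loc_subdiff \<Phi> f xb" by blast
    \<comment> \<open>With this choice the ball of radius \<open>\<kappa> * \<epsilon>\<close> in
      the supporting distance property is the given ball of subgradients.\<close>
    define \<epsilon> where "\<epsilon> = e / \<kappa>"
    have \<epsilon>: "\<epsilon> > 0" "\<kappa> * \<epsilon> = e" using e \<kappa> by (auto simp: \<epsilon>_def)
    \<comment> \<open>An error of \<open>\<epsilon> / 2\<close> leaves half of the slope
      \<open>\<epsilon>\<close> supplied by the supporting distance property.\<close>
    obtain r1 where r1: "r1 > 0"
      and supp: "\<And>\<phi> x. \<phi> \<in> cball 0 e \<inter> \<Phi> \<Longrightarrow> x \<in> cball xb r1 \<Longrightarrow>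
        ereal (lip_incr \<phi> x xb - \<epsilon> / 2 * dist x xb) \<le> f x - f xb"
      using loc_subdiff_uniform_radius[where f = f, OF assms(1) assms(3)[OF zero] sub, of "\<epsilon> / 2"] \<epsilon>
      by auto
    obtain r2 where r2: "r2 > 0"
      and dist_le: "\<And>x. x \<in> cball xb r2 \<Longrightarrow>
        ereal (\<epsilon> * dist x xb) \<le> (SUP \<phi>\<in>cball 0 e \<inter> \<Phi>. ereal (lip_incr \<phi> x xb))"
      using lsd[OF \<epsilon>(1)] \<epsilon>(2) by auto
    have "ereal (\<epsilon> / 2 * dist x xb) \<le> f x - f xb" if x: "x \<in> cball xb (min r1 r2)" for x
    proof -
      have "ereal (\<epsilon> * dist x xb) \<le> (SUP \<phi>\<in>cball 0 e \<inter> \<Phi>. ereal (lip_incr \<phi> x xb))"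
        using x by (intro dist_le) auto
      \<comment> \<open>The radius \<open>r1\<close> is common to all \<open>\<phi>\<close> in the
        ball, so at this fixed \<open>x\<close> the bound holds for each of them and passes to the
        supremum.\<close>
      also have "\<dots> \<le> (f x - f xb) + ereal (\<epsilon> / 2 * dist x xb)"
      proof (rule SUP_least)
        fix \<phi> assume "\<phi> \<in> cball 0 e \<inter> \<Phi>"
        from supp[OF this, of x] x
        show "ereal (lip_incr \<phi> x xb) \<le> (f x - f xb) + ereal (\<epsilon> / 2 * dist x xb)"
          by (cases "f x - f xb") (auto simp: algebra_simps)
      qed
      finally show ?thesis
        by (cases "f x - f xb") (auto simp: field_simps)
    qed
    with \<epsilon> r1 r2 show "\<exists>c>0. \<exists>r>0. \<forall>x\<in>cball xb r. ereal (c * dist x xb) \<le> f x - f xb"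
      by (intro exI[of _ "\<epsilon> / 2"] exI[of _ "min r1 r2"] conjI) auto
  qed
qed

end
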